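(* Let $\beta$ be a number and let $c_n=\beta^n C_n$ for $n\ge 0$, where $C_n$ is the $n$-th Catalan number. Let $k\ge 1$ be an integer. Then for every $l=0,1,\ldots,k-1$, $$\det[c_{i+j+\chi(j\ge l)+1}]_{0\le i,j\le k-1}=\beta^{k^2+k-l}\binom{l+k+1}{2l+1}.$$
   Context: $C_n=\frac{1}{n+1}\binom{2n}{n}$ is the $n$-th Catalan number. For a statement $P$, $\chi(P)=1$ if $P$ is true and $\chi(P)=0$ otherwise. *)

theory Defs
  imports "Jordan_Normal_Form.Determinant"
begin

definition catalan :: "nat \<Rightarrow> 'a::field_char_0" where
  "catalan n = 1 / of_nat (n + 1) * of_nat ((2 * n) choose n)"

end

theory Submission
  imports Defs
begin

text \<open>
  The determinant is the maximal minor of the \<open>k \<times> (k + 1)\<close> Hankel matrix of the moments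
  \<open>c (n + 1)\<close> that omits column \<open>l\<close>. The kernel of this Hankel matrix contains the coefficient
  vector of the \<open>k\<close>-th orthogonal polynomial, a rescaled Chebyshev polynomial of the second kind, whose
  coefficients are signed binomials. Multiplying by a unitriangular matrix with this vector as its last
  column reduces the minor to the Hankel determinant of order \<open>k\<close>, which the same trick evaluates
  recursively.
\<close>

text \<open>The coefficient of x^j in the monic polynomial p_k(x) = U_k(x/2 - 1), with U_k the
  Chebyshev polynomial of the second kind.\<close>

definition cheb_coeff :: "nat \<Rightarrow> nat \<Rightarrow> 'a::field_char_0" where
  "cheb_coeff k j = (- 1) ^ (k + j) * of_nat ((k + j + 1) choose (2 * j + 1))"

text \<open>By the reflection principle this counts walks of \<open>2 * i + 1\<close> steps up or
  down by 1 that start at 0, end at \<open>2 * k + 1\<close> and never go below 0.\<close>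

definition ballot :: "nat \<Rightarrow> nat \<Rightarrow> 'a::field_char_0" where
  "ballot i k = of_nat ((2 * i + 1) choose (i + k + 1)) - of_nat ((2 * i + 1) choose (i + k + 2))"

lemma cheb_coeff_eq_0: "k < j \<Longrightarrow> cheb_coeff k j = 0"
  by (simp add: cheb_coeff_def binomial_eq_0 del: binomial_Suc_Suc)

lemma cheb_coeff_same: "cheb_coeff k k = 1"
  by (simp add: cheb_coeff_def flip: mult_2)

lemma cheb_coeff_rec_0:
  "cheb_coeff (Suc (Suc k)) 0 = - 2 * cheb_coeff (Suc k) 0 - (cheb_coeff k 0 :: 'a::field_char_0)"
  by (simp add: cheb_coeff_def algebra_simps)

text \<open>Coefficient form of p_(k+2) = (x - 2) p_(k+1) - p_k, obtained from Pascal's rule. At x^0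
  the shifted term is absent, hence the separate case before.\<close>

lemma cheb_coeff_rec_Suc:
  "cheb_coeff (Suc (Suc k)) (Suc j) =
     cheb_coeff (Suc k) j - 2 * cheb_coeff (Suc k) (Suc j) - (cheb_coeff k (Suc j) :: 'a::field_char_0)"
  by (simp add: cheb_coeff_def algebra_simps)

lemma ballot_rec_0: "ballot (Suc i) 0 = 2 * ballot i 0 + (ballot i 1 :: 'a::field_char_0)"
proof -
  \<comment> \<open>Pascal's rule applied twice leaves this one binomial outside the range of
    \<open>ballot i\<close>; symmetry folds it back.\<close>
  have "(2 * i + 1) choose i = (2 * i + 1) choose (i + 1)"
    by (subst binomial_symmetric) auto
  then show ?thesis
    by (simp add: ballot_def numeral_eq_Suc)
qed

lemma ballot_rec_Suc:
  "ballot (Suc i) (Suc k) =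
     ballot i k + 2 * ballot i (Suc k) + (ballot i (Suc (Suc k)) :: 'a::field_char_0)"
  by (simp add: ballot_def numeral_eq_Suc)

lemma ballot_same: "ballot k k = 1"
  by (simp add: ballot_def binomial_eq_0 flip: mult_2)

lemma ballot_eq_0: "i < k \<Longrightarrow> ballot i k = 0"
  by (simp add: ballot_def binomial_eq_0 del: binomial_Suc_Suc)

lemma ballot_0: "ballot i 0 = (catalan (Suc i) :: 'a::field_char_0)"
proof -
  define a b where "a = (2 * i + 1) choose (i + 1)" and "b = (2 * i + 1) choose (i + 2)"
  have "(2 * i + 1) choose i = a"
    unfolding a_def by (subst binomial_symmetric) auto
  then have central: "(2 * Suc i) choose (Suc i) = 2 * a"
    by (simp add: a_def)
  \<comment> \<open>Hence a - b = 2 a / (i + 2), the central binomial divided by i + 2.\<close>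
  have "(i + 2) * b = i * a"
    using binomial_absorption[of "i + 1" "2 * i + 1"] binomial_absorb_comp[of "2 * i + 1" "i + 1"]
    by (simp add: a_def b_def del: binomial_Suc_Suc)
  then have "of_nat (i + 2) * of_nat b = (of_nat i * of_nat a :: 'a)"
    by (metis of_nat_mult)
  moreover have "of_nat (Suc (Suc i)) \<noteq> (0 :: 'a)"
    by (rule of_nat_neq_0)
  moreover have ballot: "ballot i 0 = (of_nat a - of_nat b :: 'a)"
    by (simp only: ballot_def a_def b_def add_0_right)
  ultimately show ?thesis
    unfolding catalan_def central by (simp add: ballot field_simps)
qed

text \<open>The left side applies the functional x^n -> \<open>catalan (n + 1)\<close> to x^i p_k.
  The recurrence of p_k turns multiplication by x into a shift of \<open>i\<close>, and
  \<open>ballot\<close> obeys the same recurrence.\<close>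

lemma sum_catalan_cheb_coeff:
  assumes "k \<le> N"
  shows "(\<Sum>j\<le>N. catalan (i + j + 1) * cheb_coeff k j) = (ballot i k :: 'a::field_char_0)"
proof -
  define T where "T = (\<lambda>k i. \<Sum>j\<le>k. catalan (i + j + 1) * cheb_coeff k j :: 'a)"
  \<comment> \<open>Padding with zero coefficients gives the sums for different \<open>k\<close> a
    common range.\<close>
  have T: "T k i = (\<Sum>j\<le>N. catalan (i + j + 1) * cheb_coeff k j)" if "k \<le> N" for k i N
    unfolding T_def by (rule sum.mono_neutral_left) (use that in \<open>auto simp: cheb_coeff_eq_0\<close>)
  have rec: "T (Suc (Suc k)) i = T (Suc k) (Suc i) - 2 * T (Suc k) i - T k i" for k i
  proof -
    have shift: "catalan (i + 1) * cheb_coeff m 0 +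
        (\<Sum>j\<le>Suc k. catalan (i + j + 2) * cheb_coeff m (Suc j)) = T m i" if "m \<le> Suc k" for m
      using that by (subst T[of m "Suc (Suc k)"])
        (simp_all add: sum.atMost_Suc_shift[of _ "Suc k"] del: sum.atMost_Suc)
    have "T (Suc (Suc k)) i = catalan (i + 1) * cheb_coeff (Suc (Suc k)) 0 +
        (\<Sum>j\<le>Suc k. catalan (i + j + 2) * cheb_coeff (Suc (Suc k)) (Suc j))"
      unfolding T_def by (subst sum.atMost_Suc_shift) simp
    also have "\<dots> = (\<Sum>j\<le>Suc k. catalan (Suc i + j + 1) * cheb_coeff (Suc k) j)
       - 2 * (catalan (i + 1) * cheb_coeff (Suc k) 0
           + (\<Sum>j\<le>Suc k. catalan (i + j + 2) * cheb_coeff (Suc k) (Suc j)))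
       - (catalan (i + 1) * cheb_coeff k 0
           + (\<Sum>j\<le>Suc k. catalan (i + j + 2) * cheb_coeff k (Suc j)))"
      unfolding cheb_coeff_rec_0 cheb_coeff_rec_Suc
      by (simp add: algebra_simps sum.distrib sum_subtractf sum_distrib_left del: sum.atMost_Suc)
    also have "\<dots> = T (Suc k) (Suc i) - 2 * T (Suc k) i - T k i"
      by (simp only: shift le_refl le_SucI T[OF le_refl])
    finally show ?thesis .
  qed
  \<comment> \<open>The recurrence has order two in \<open>k\<close>, so consecutive values are
    carried together; it also moves \<open>i\<close>, which must stay arbitrary.\<close>
  have "T k i = ballot i k \<and> T (Suc k) i = ballot i (Suc k)" for k i
  proof (induction k arbitrary: i)
    case 0
    have "T 0 i = ballot i 0" for i
      by (simp add: T_def cheb_coeff_same ballot_0)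
    moreover have "T (Suc 0) i = T 0 (Suc i) - 2 * T 0 i"
      by (simp add: T_def cheb_coeff_def numeral_eq_Suc)
    ultimately show ?case
      by (simp add: ballot_rec_0)
  next
    case (Suc k)
    then show ?case
      by (simp add: rec ballot_rec_Suc)
  qed
  then show ?thesis
    using T[OF assms] by metis
qed

text \<open>The weights \<open>\<beta> ^ (k - j)\<close> give every summand the same power of
  \<open>\<beta>\<close>, which then factors out.\<close>

lemma sum_scaled_catalan_cheb_coeff:
  fixes \<beta> :: "'a::field_char_0"
  shows "(\<Sum>j\<le>k. \<beta> ^ (i + j + 1) * catalan (i + j + 1) * (\<beta> ^ (k - j) * cheb_coeff k j)) =
           \<beta> ^ (i + k + 1) * ballot i k"
proof -
  have "\<beta> ^ (i + j + 1) * \<beta> ^ (k - j) = \<beta> ^ (i + k + 1)" if "j \<le> k" for j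
    using that by (simp flip: power_add)
  then have "(\<Sum>j\<le>k. \<beta> ^ (i + j + 1) * catalan (i + j + 1) * (\<beta> ^ (k - j) * cheb_coeff k j)) =
      (\<Sum>j\<le>k. \<beta> ^ (i + k + 1) * (catalan (i + j + 1) * cheb_coeff k j))"
    by (intro sum.cong) (auto simp: algebra_simps)
  then show ?thesis
    by (simp only: sum_catalan_cheb_coeff[OF le_refl] flip: sum_distrib_left)
qed

text \<open>Replacing the last column by the combination with weights \<open>v\<close> keeps the
  determinant and clears that column above its bottom entry. Row \<open>k\<close> is unrestricted,
  so it may be a Hankel row or a unit row.\<close>

lemma det_kernel_vector:
  fixes f :: "nat \<Rightarrow> nat \<Rightarrow> 'a::idom"
  assumes ker: "\<And>i. i < k \<Longrightarrow> (\<Sum>j\<le>k. f i j * v j) = 0" and v: "v k = 1"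
  shows "det (mat (Suc k) (Suc k) (\<lambda>(i, j). f i j)) =
           (\<Sum>j\<le>k. f k j * v j) * det (mat k k (\<lambda>(i, j). f i j))"
proof -
  let ?A = "mat (Suc k) (Suc k) (\<lambda>(i, j). f i j)"
  define U where "U = mat (Suc k) (Suc k) (\<lambda>(i, j). if j = k then v i else if i = j then 1 else 0)"
  define B where "B = ?A * U"
  have U: "U \<in> carrier_mat (Suc k) (Suc k)" and B: "B \<in> carrier_mat (Suc k) (Suc k)"
    by (auto simp: U_def B_def)
  have "det U = prod_list (diag_mat U)"
    by (rule det_upper_triangular[OF _ U]) (auto simp: U_def)
  also have "\<dots> = 1"
    unfolding prod_list_diag_prod using U v by (auto simp: U_def intro!: prod.neutral)
  finally have det_B: "det B = det ?A"
    unfolding B_def by (subst det_mult[OF _ U]) auto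
  have B_entry: "B $$ (i, j) = (if j = k then \<Sum>j\<le>k. f i j * v j else f i j)"
    if "i \<le> k" "j \<le> k" for i j
  proof -
    have "B $$ (i, j) = (\<Sum>m\<le>k. f i m * U $$ (m, j))"
      using that unfolding B_def U_def
      by (auto simp: scalar_prod_def atLeast0LessThan lessThan_Suc_atMost)
    also have "\<dots> = (\<Sum>m\<le>k. f i m * (if j = k then v m else if m = j then 1 else 0))"
      using that by (intro sum.cong) (auto simp: U_def)
    also have "\<dots> = (if j = k then \<Sum>j\<le>k. f i j * v j else f i j)"
      using that by (auto simp: if_distrib[of "\<lambda>x. _ * x"] sum.delta cong: if_cong)
    finally show ?thesis .
  qed
  have "det B = (\<Sum>i<Suc k. B $$ (i, k) * cofactor B i k)"
    by (rule laplace_expansion_column[OF B]) simp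
  also have "\<dots> = B $$ (k, k) * cofactor B k k"
    using ker by (simp add: B_entry)
  also have "mat_delete B k k = mat k k (\<lambda>(i, j). f i j)"
    using B by (intro eq_matI) (auto simp: mat_delete_def B_entry)
  then have "cofactor B k k = det (mat k k (\<lambda>(i, j). f i j))"
    by (simp add: cofactor_def)
  finally show ?thesis
    using det_B B_entry[of k k] by simp
qed

lemma det_hankel_catalan:
  fixes \<beta> :: "'a::field_char_0"
  shows "det (mat k k (\<lambda>(i, j). \<beta> ^ (i + j + 1) * catalan (i + j + 1))) = \<beta> ^ k\<^sup>2"
proof (induction k)
  case 0
  show ?case by (simp add: det_def)
next
  case (Suc k)
  have "det (mat (Suc k) (Suc k) (\<lambda>(i, j). \<beta> ^ (i + j + 1) * catalan (i + j + 1))) =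
      \<beta> ^ (k + k + 1) * \<beta> ^ k\<^sup>2"
    by (subst det_kernel_vector[where v = "\<lambda>j. \<beta> ^ (k - j) * cheb_coeff k j"])
      (simp_all only: sum_scaled_catalan_cheb_coeff Suc.IH ballot_same ballot_eq_0 cheb_coeff_same
        diff_self_eq_0 power_0 mult_1_right mult_zero_right)
  also have "\<dots> = \<beta> ^ (Suc k)\<^sup>2"
    by (simp add: power2_eq_square add.assoc flip: power_add power_Suc)
  finally show ?case .
qed

theorem lemma7p2:
  fixes \<beta> :: "'a::field_char_0" and c :: "nat \<Rightarrow> 'a" and k l :: nat
  assumes c: "\<And>n. c n = \<beta> ^ n * catalan n"
    and k: "k \<ge> 1"
    and l: "l \<in> {0..k - 1}"
  shows "det (mat k k (\<lambda>(i, j). c (i + j + of_bool (j \<ge> l) + 1)))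
    = \<beta> ^ (k\<^sup>2 + k - l) * of_nat ((l + k + 1) choose (2 * l + 1))"
proof -
  have lk: "l < k" using k l by auto
  \<comment> \<open>Expanding along the unit row \<open>k\<close> deletes column \<open>l\<close> from the Hankel rows.\<close>
  define f where "f = (\<lambda>i j. if i < k then c (i + j + 1) else of_bool (j = l))"
  define A where "A = mat (Suc k) (Suc k) (\<lambda>(i, j). f i j)"
  define v where "v = (\<lambda>j. \<beta> ^ (k - j) * cheb_coeff k j)"
  let ?M = "mat k k (\<lambda>(i, j). c (i + j + of_bool (j \<ge> l) + 1))"
  have A: "A \<in> carrier_mat (Suc k) (Suc k)" by (simp add: A_def)
  have "det A = (\<Sum>j<Suc k. A $$ (k, j) * cofactor A k j)"
    by (rule laplace_expansion_row[OF A]) simp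
  also have "\<dots> = (\<Sum>j<Suc k. if j = l then cofactor A k j else 0)"
    by (intro sum.cong) (auto simp: A_def f_def)
  also have "\<dots> = cofactor A k l"
    using lk by (subst sum.delta) auto
  \<comment> \<open>Columns from \<open>l\<close> on move one place left, which produces the
    \<open>of_bool\<close> shift.\<close>
  also have "mat_delete A k l = ?M"
    using A by (intro eq_matI) (auto simp: mat_delete_def A_def f_def)
  then have "cofactor A k l = (- 1) ^ (k + l) * det ?M"
    by (simp add: cofactor_def)
  finally have minor: "det A = (- 1) ^ (k + l) * det ?M" .

  have "det A = (\<Sum>j\<le>k. f k j * v j) * det (mat k k (\<lambda>(i, j). f i j))"
    unfolding A_def
  proof (rule det_kernel_vector)
    show "(\<Sum>j\<le>k. f i j * v j) = 0" if "i < k" for i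
      using that sum_scaled_catalan_cheb_coeff[where \<beta> = \<beta> and i = i and k = k]
      by (simp add: f_def v_def c ballot_eq_0)
    show "v k = 1"
      by (simp add: v_def cheb_coeff_same)
  qed
  also have "mat k k (\<lambda>(i, j). f i j) = mat k k (\<lambda>(i, j). \<beta> ^ (i + j + 1) * catalan (i + j + 1))"
    by (intro eq_matI) (auto simp: f_def c)
  also have "(\<Sum>j\<le>k. f k j * v j) = (\<Sum>j\<le>k. if j = l then v j else 0)"
    by (intro sum.cong) (auto simp: f_def)
  also have "\<dots> = v l"
    using lk by (subst sum.delta) auto
  finally have "(- 1) ^ (k + l) * det ?M = v l * \<beta> ^ k\<^sup>2"
    unfolding det_hankel_catalan minor .
  \<comment> \<open>The sign of \<open>cheb_coeff k l\<close> equals the cofactor sign, so the two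
    cancel.\<close>
  then have "(- 1) ^ (k + l) * det ?M =
      (- 1) ^ (k + l) * (\<beta> ^ (k - l) * \<beta> ^ k\<^sup>2 * of_nat ((k + l + 1) choose (2 * l + 1)))"
    by (simp add: v_def cheb_coeff_def algebra_simps)
  then have "det ?M = \<beta> ^ (k - l) * \<beta> ^ k\<^sup>2 * of_nat ((k + l + 1) choose (2 * l + 1))"
    by (simp only: mult_cancel_left) simp
  also have "\<beta> ^ (k - l) * \<beta> ^ k\<^sup>2 = \<beta> ^ (k\<^sup>2 + k - l)"
    using lk by (simp add: add.commute flip: power_add)
  finally show ?thesis
    by (simp only: add.commute[of l k])
qed

end
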